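(* Let $\mathcal{X}\subseteq\mathbb{R}^n$, $U:\mathbb{R}^n\to\mathbb{R}^N$, $f:\mathbb{R}^N\to\mathbb{R}$, and $\gamma>0$. Let $\nu_1$ and $\nu_2$ be two convex fairness measures on $\mathbb{R}^N$ with dual sets $\mathcal{W}_1$ and $\mathcal{W}_2$, respectively. For $k\in\{1,2\}$ let $\upsilon_k^\star$ and $\mathbf{x}_k^\star$ be the optimal value and an optimal solution of $$\min_{\mathbf{x},\mathbf{u}}\{f(\mathbf{u})+\gamma\nu_k(\mathbf{u})\mid\mathbf{u}=U(\mathbf{x}),\ \mathbf{x}\in\mathcal{X}\}.$$ Assume that $\mathcal{X}$ is compact. Then the following statements hold. (a) We have $|\upsilon_1^\star-\upsilon_2^\star|\le\gamma\,U_{\max}\,d_H(\mathcal{W}_1,\mathcal{W}_2)$, where $U_{\max}=\max_{\mathbf{x}\in\mathcal{X}}\|U(\mathbf{x})\|_2<\infty$. (b) Let $\mathbf{w}_k^\star\in\arg\max_{\mathbf{w}\in\mathcal{W}_k}\nu_{\mathbf{w}}(U(\mathbf{x}_k^\star))$ for $k\in\{1,2\}$. Assume that the following quadratic growth condition holds for $k\in\{1,2\}$: there exists $\tau_k>0$ such that $$f(U(\mathbf{x}))+\gamma\nu_{\mathbf{w}_k^\star}(U(\mathbf{x}))-f(U(\mathbf{x}_k^\star))-\gamma\nu_{\mathbf{w}_k^\star}(U(\mathbf{x}_k^\star))\ge\tau_k\|\mathbf{x}-\mathbf{x}_k^\star\|_2^2\quad\text{for all }\mathbf{x}\in\mathcal{X}.$$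 Then $$\|\mathbf{x}_1^\star-\mathbf{x}_2^\star\|_2\le\sqrt{\frac{\gamma U_{\max}}{\min\{\tau_1,\tau_2\}}}\cdot d_H^{1/2}(\mathcal{W}_1,\mathcal{W}_2).$$
   Context: $u_{(i)}$ is the $i$th smallest entry of $\mathbf{u}\in\mathbb{R}^N$; $\nu_{\mathbf{w}}(\mathbf{u})=\sum_{i=1}^N w_iu_{(i)}$ for $\mathbf{w}\in\mathbb{R}^N$; $\mathbf{1}$ is the all-ones vector; $\mathcal{S}^N=\{\mathbf{w}\in\mathbb{R}^N\mid w_1\le\dots\le w_N,\ \mathbf{1}^\top\mathbf{w}=0\}$. A function $\phi:\mathbb{R}^N\to\mathbb{R}$ is a convex fairness measure if it is continuous; $\phi\ge0$ with $\phi(\mathbf{u})=0$ iff $\mathbf{u}=\alpha\mathbf{1}$ for some $\alpha\in\mathbb{R}$; $\phi(P\mathbf{u})=\phi(\mathbf{u})$ for every permutation matrix $P$; $\phi(\mathbf{u}+\alpha\mathbf{1})=\phi(\mathbf{u})$ for all $\alpha\in\mathbb{R}$; $\phi(\alpha\mathbf{u})=\alpha\phi(\mathbf{u})$ for all $\alpha>0$; and $\phi$ is convex. A dual set of a convex fairness measure $\nu$ is a compact set $\mathcal{W}_\nu\subseteq\mathcal{S}^N$, $\mathcal{W}_\nu\neq\{\mathbf{0}\}$, such that $\nu(\mathbf{u})=\sup_{\mathbf{w}\in\mathcal{W}_\nu}\nu_{\mathbf{w}}(\mathbf{u})$ for all $\mathbf{u}\in\mathbb{R}^N$. $d(\mathbf{w},\mathcal{W})=\inf_{\tilde{\mathbf{w}}\in\mathcal{W}}\|\mathbf{w}-\tilde{\mathbf{w}}\|_2$,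 and the Hausdorff distance is $d_H(\mathcal{W}_1,\mathcal{W}_2)=\max\{\sup_{\mathbf{w}_2\in\mathcal{W}_2}d(\mathbf{w}_2,\mathcal{W}_1),\ \sup_{\mathbf{w}_1\in\mathcal{W}_1}d(\mathbf{w}_1,\mathcal{W}_2)\}$.
   Formalization: Compactness of X alone does not make U_max finite for arbitrary U; existence of the maximum U_max is claimed only when U is continuous on X, and (a) and (b) are stated for every U for which this maximum exists. *)

theory Defs
  imports "HOL-Analysis.Analysis"
begin

text \<open>
  The coordinates of \<open>\<real>\<^sup>N\<close> are indexed by a finite linearly ordered type; the number of indices
  below \<open>i\<close> is the zero-based position of \<open>i\<close>, so \<open>order_stat u i\<close> is the entry \<open>u\<^sub>(\<^sub>i\<^sub>)\<close> of
  \<open>u\<close> sorted in nondecreasing order, with multiplicity.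
\<close>

definition order_stat :: "real ^ 'N::{finite,linorder} \<Rightarrow> 'N \<Rightarrow> real" where
  "order_stat u i =
     sorted_list_of_multiset (image_mset (\<lambda>j. u $ j) (mset_set UNIV)) ! card {j. j < i}"

definition nu :: "real ^ 'N::{finite,linorder} \<Rightarrow> real ^ 'N::{finite,linorder} \<Rightarrow> real" where
  "nu w u = (\<Sum>i\<in>UNIV. w $ i * order_stat u i)"

definition weight_cone :: "(real ^ 'N::{finite,linorder}) set" where
  "weight_cone = {w. (\<forall>i j. i \<le> j \<longrightarrow> w $ i \<le> w $ j) \<and> 1 \<bullet> w = 0}"

definition permutation_matrix :: "real ^ 'N ^ 'N \<Rightarrow> bool" where
  "permutation_matrix P \<longleftrightarrow>
     (\<exists>p. p permutes UNIV \<and> P = (\<chi> i j. if j = p i then 1 else 0))"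

text \<open>The vector \<open>1\<close> of type \<open>real ^ 'N\<close> is the all-ones vector.\<close>

definition convex_fairness_measure :: "(real ^ 'N \<Rightarrow> real) \<Rightarrow> bool" where
  "convex_fairness_measure \<phi> \<longleftrightarrow>
     continuous_on UNIV \<phi> \<and>
     (\<forall>u. \<phi> u \<ge> 0) \<and>
     (\<forall>u. \<phi> u = 0 \<longleftrightarrow> (\<exists>\<alpha>. u = \<alpha> *\<^sub>R 1)) \<and>
     (\<forall>P u. permutation_matrix P \<longrightarrow> \<phi> (P *v u) = \<phi> u) \<and>
     (\<forall>u \<alpha>. \<phi> (u + \<alpha> *\<^sub>R 1) = \<phi> u) \<and>
     (\<forall>u \<alpha>. \<alpha> > 0 \<longrightarrow> \<phi> (\<alpha> *\<^sub>R u) = \<alpha> * \<phi> u) \<and>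
     convex_on UNIV \<phi>"

text \<open>
  Nonemptiness is implicit in the mathematical definition (a supremum over the empty set is
  \<open>-\<infinity>\<close>), but has to be stated here because \<open>Sup {}\<close> is an unspecified real number. For nonempty
  compact \<open>W\<close> the suprema below are finite.
\<close>

definition dual_set :: "(real ^ 'N::{finite,linorder} \<Rightarrow> real) \<Rightarrow> (real ^ 'N::{finite,linorder}) set \<Rightarrow> bool" where
  "dual_set \<phi> W \<longleftrightarrow>
     compact W \<and> W \<subseteq> weight_cone \<and> W \<noteq> {} \<and> W \<noteq> {0} \<and>
     (\<forall>u. \<phi> u = (SUP w\<in>W. nu w u))"

text \<open>
  For \<open>B \<noteq> {}\<close>, \<open>infdist a B\<close> is the infimum of \<open>dist a b\<close> over \<open>b \<in> B\<close>. The suprema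
  are finite for nonempty bounded sets.
\<close>

definition hausdorff_dist :: "'a::metric_space set \<Rightarrow> 'a set \<Rightarrow> real" where
  "hausdorff_dist A B = max (SUP b\<in>B. infdist b A) (SUP a\<in>A. infdist a B)"

definition feasible :: "('a \<Rightarrow> 'b) \<Rightarrow> 'a set \<Rightarrow> ('a \<times> 'b) set" where
  "feasible U X = {(x, u). u = U x \<and> x \<in> X}"

definition objective :: "('b \<Rightarrow> real) \<Rightarrow> real \<Rightarrow> ('b \<Rightarrow> real) \<Rightarrow> 'a \<times> 'b \<Rightarrow> real" where
  "objective f \<gamma> \<phi> = (\<lambda>(x, u). f u + \<gamma> * \<phi> u)"

definition optimal_value ::
  "('b \<Rightarrow> real) \<Rightarrow> real \<Rightarrow> ('b \<Rightarrow> real) \<Rightarrow> ('a \<Rightarrow> 'b) \<Rightarrow> 'a set \<Rightarrow> real" where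
  "optimal_value f \<gamma> \<phi> U X = (INF p\<in>feasible U X. objective f \<gamma> \<phi> p)"

text \<open>The \<open>x\<close>-component of a minimiser \<open>(x, u)\<close>.\<close>

definition optimal_solution ::
  "('b \<Rightarrow> real) \<Rightarrow> real \<Rightarrow> ('b \<Rightarrow> real) \<Rightarrow> ('a \<Rightarrow> 'b) \<Rightarrow> 'a set \<Rightarrow> 'a \<Rightarrow> bool" where
  "optimal_solution f \<gamma> \<phi> U X x \<longleftrightarrow>
     (\<exists>u. is_arg_min (objective f \<gamma> \<phi>) (\<lambda>p. p \<in> feasible U X) (x, u))"

definition is_maximum :: "('a \<Rightarrow> real) \<Rightarrow> 'a set \<Rightarrow> real \<Rightarrow> bool" where
  "is_maximum g X m \<longleftrightarrow> (\<exists>x\<in>X. g x = m) \<and> (\<forall>x\<in>X. g x \<le> m)"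

definition quadratic_growth ::
  "(real ^ 'N::{finite,linorder} \<Rightarrow> real) \<Rightarrow> real \<Rightarrow> ('a::real_normed_vector \<Rightarrow> real ^ 'N::{finite,linorder}) \<Rightarrow> 'a set
     \<Rightarrow> real ^ 'N::{finite,linorder} \<Rightarrow> 'a \<Rightarrow> real \<Rightarrow> bool" where
  "quadratic_growth f \<gamma> U X w x0 \<tau> \<longleftrightarrow>
     (\<forall>x\<in>X. f (U x) + \<gamma> * nu w (U x) - f (U x0) - \<gamma> * nu w (U x0) \<ge> \<tau> * (norm (x - x0))\<^sup>2)"

end

theory Submission
  imports Defs
begin

text \<open>
  Sorting preserves the Euclidean norm, so by Cauchy--Schwarz \<open>nu w u\<close> is Lipschitz in \<open>w\<close> with
  constant \<open>norm u\<close>. Taking suprema over the dual sets, the two fairness measures differ at \<open>u\<close> by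
  at most \<open>norm u\<close> times the Hausdorff distance. Comparing each objective at the other problem's
  solution yields (a); adding the two growth inequalities, each taken at the other problem's
  solution, yields (b).
\<close>

text \<open>Strict monotonicity gives injectivity, and an injection between finite sets of equal
  size is onto. This turns sums over the index type into sums over list positions.\<close>

lemma bij_betw_card_less:
  "bij_betw (\<lambda>i::'a::{finite,linorder}. card {j. j < i}) UNIV {..<CARD('a)}"
proof -
  have less: "card {j::'a. j < a} < card {j. j < b}" if "a < b" for a b :: 'a
    by (rule psubset_card_mono) (use that in auto)
  have inj: "inj (\<lambda>i::'a. card {j. j < i})"
    by (rule linorder_injI) (use less in force)
  moreover have "card {j::'a. j < i} < CARD('a)" for i :: 'a
    by (rule psubset_card_mono) auto
  then have "range (\<lambda>i::'a. card {j. j < i}) \<subseteq> {..<CARD('a)}"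
    by auto
  moreover have "card (range (\<lambda>i::'a. card {j. j < i})) = CARD('a)"
    using inj by (rule card_image)
  ultimately show ?thesis
    by (metis bij_betw_def card_lessThan card_subset_eq finite_lessThan)
qed

text \<open>Sorting only rearranges the entries, and a commutative sum depends only on their
  multiset. The case of squares gives invariance of the norm.\<close>

lemma sum_order_stat:
  fixes u :: "real ^ 'N::{finite,linorder}" and g :: "real \<Rightarrow> 'a::comm_monoid_add"
  shows "(\<Sum>i\<in>UNIV. g (order_stat u i)) = (\<Sum>i\<in>UNIV. g (u $ i))"
proof -
  define xs where "xs = sorted_list_of_multiset (image_mset (\<lambda>j. u $ j) (mset_set UNIV))"
  have mset: "mset xs = image_mset (\<lambda>j. u $ j) (mset_set UNIV)"
    by (simp add: xs_def)
  then have len: "length xs = CARD('N)"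
    by (metis size_image_mset size_mset size_mset_set)
  have "(\<Sum>i\<in>UNIV. g (order_stat u i)) = (\<Sum>i\<in>(UNIV::'N set). g (xs ! card {j. j < i}))"
    by (simp add: order_stat_def xs_def)
  also have "\<dots> = (\<Sum>k<length xs. g (xs ! k))"
    unfolding len using bij_betw_card_less by (rule sum.reindex_bij_betw)
  also have "\<dots> = sum_list (map g xs)"
    by (simp add: sum_list_sum_nth atLeast0LessThan)
  also have "\<dots> = (\<Sum>x\<in>#mset xs. g x)"
    by (simp flip: sum_mset_sum_list)
  also have "\<dots> = (\<Sum>i\<in>UNIV. g (u $ i))"
    unfolding mset by (simp add: sum_unfold_sum_mset image_mset.compositionality comp_def)
  finally show ?thesis .
qed

text \<open>Exposes linearity in \<open>w\<close> for fixed \<open>u\<close>, so that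
  Cauchy--Schwarz applies to a difference of weights.\<close>

lemma nu_eq_inner: "nu w u = w \<bullet> (\<chi> i. order_stat u i)"
  by (simp add: nu_def inner_vec_def)

lemma norm_order_stat: "norm (\<chi> i. order_stat u i) = norm u"
  using sum_order_stat[of "\<lambda>x. x\<^sup>2" u] by (simp add: norm_vec_def L2_set_def)

lemma abs_nu_le: "\<bar>nu w u\<bar> \<le> norm w * norm u"
  unfolding nu_eq_inner by (metis Cauchy_Schwarz_ineq2 norm_order_stat)

lemma nu_diff_le: "nu w u - nu w' u \<le> dist w w' * norm u"
  using abs_nu_le[of "w - w'" u] by (simp add: nu_eq_inner inner_diff_left dist_norm)

lemma bdd_above_nu:
  assumes "bounded W"
  shows "bdd_above ((\<lambda>w. nu w u) ` W)"
proof -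
  obtain B where "\<And>w. w \<in> W \<Longrightarrow> norm w \<le> B"
    using assms by (auto simp: bounded_iff)
  then have "nu w u \<le> B * norm u" if "w \<in> W" for w
    using that by (meson abs_le_D1 abs_nu_le mult_right_mono norm_ge_zero order_trans)
  then show ?thesis
    by (rule bdd_aboveI2)
qed

lemma nu_le_dual_set:
  assumes "dual_set \<phi> W" "w \<in> W"
  shows "nu w u \<le> \<phi> u"
proof -
  have "bounded W" and eq: "\<phi> u = (SUP w\<in>W. nu w u)"
    using assms(1) by (auto simp: dual_set_def compact_imp_bounded)
  from this(1) show ?thesis
    unfolding eq using assms(2) by (intro cSUP_upper bdd_above_nu)
qed

lemma hausdorff_dist_commute: "hausdorff_dist A B = hausdorff_dist B A"
  by (simp add: hausdorff_dist_def max.commute)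

text \<open>Compactness of \<open>A\<close> bounds the continuous function \<open>infdist\<close> to
  \<open>B\<close> on \<open>A\<close>, so the supremum in the definition really is an upper
  bound.\<close>

lemma infdist_le_hausdorff_dist:
  assumes "compact A" "a \<in> A"
  shows "infdist a B \<le> hausdorff_dist A B"
proof -
  have "compact ((\<lambda>a. infdist a B) ` A)"
    by (intro compact_continuous_image continuous_intros assms)
  then have "bdd_above ((\<lambda>a. infdist a B) ` A)"
    by (simp add: bounded_imp_bdd_above compact_imp_bounded)
  with assms(2) have "infdist a B \<le> (SUP a\<in>A. infdist a B)"
    by (rule cSUP_upper)
  then show ?thesis
    by (simp add: hausdorff_dist_def)
qed

lemma hausdorff_dist_nonneg:
  assumes "compact A" "A \<noteq> {}"
  shows "0 \<le> hausdorff_dist A B"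
  using assms infdist_le_hausdorff_dist infdist_nonneg by (metis ex_in_conv order_trans)

text \<open>Each \<open>w\<close> in \<open>W\<close> has a point of \<open>V\<close> within the
  Hausdorff distance, and moving there changes \<open>nu\<close> by at most that distance times
  \<open>norm u\<close>. The reverse bound follows by exchanging the two measures.\<close>

lemma dual_set_diff_le:
  assumes "dual_set \<phi> W" "dual_set \<psi> V"
  shows "\<phi> u - \<psi> u \<le> norm u * hausdorff_dist W V"
proof -
  have W: "compact W" "W \<noteq> {}" "\<phi> u = (SUP w\<in>W. nu w u)" and V: "closed V" "V \<noteq> {}"
    using assms by (auto simp: dual_set_def compact_imp_closed)
  have "nu w u \<le> \<psi> u + norm u * hausdorff_dist W V" if "w \<in> W" for w
  proof -
    obtain v where v: "v \<in> V" "infdist w V = dist w v"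
      using infdist_attains_inf[OF V] by metis
    have "nu w u - nu v u \<le> dist w v * norm u"
      by (rule nu_diff_le)
    also have "\<dots> \<le> hausdorff_dist W V * norm u"
      using infdist_le_hausdorff_dist[OF W(1) that, of V] v(2) by (simp add: mult_right_mono)
    finally show ?thesis
      using nu_le_dual_set[OF assms(2) v(1), of u] by (simp add: mult.commute)
  qed
  then have "\<phi> u \<le> \<psi> u + norm u * hausdorff_dist W V"
    unfolding W(3) using W(2) by (intro cSUP_least)
  then show ?thesis by simp
qed

text \<open>The constraint forces \<open>u = U x\<close>, so minimising over pairs reduces to
  minimising over \<open>X\<close> alone.\<close>

lemma optimal_solutionD:
  assumes "optimal_solution f \<gamma> \<phi> U X x"
  shows "x \<in> X"
    and "y \<in> X \<Longrightarrow> f (U x) + \<gamma> * \<phi> (U x) \<le> f (U y) + \<gamma> * \<phi> (U y)"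
    and "optimal_value f \<gamma> \<phi> U X = f (U x) + \<gamma> * \<phi> (U x)"
proof -
  show x: "x \<in> X"
    using assms by (auto simp: optimal_solution_def is_arg_min_def feasible_def)
  show le: "f (U x) + \<gamma> * \<phi> (U x) \<le> f (U y) + \<gamma> * \<phi> (U y)" if "y \<in> X" for y
    using assms that
    by (force simp: optimal_solution_def is_arg_min_linorder feasible_def objective_def)
  show "optimal_value f \<gamma> \<phi> U X = f (U x) + \<gamma> * \<phi> (U x)"
    unfolding optimal_value_def
    \<comment> \<open>The infimum is attained at \<open>(x, U x)\<close>, which also settles
      boundedness from below.\<close>
    by (rule cInf_eq_minimum)
      (use x le in \<open>force simp: feasible_def objective_def\<close>)+
qed

text \<open>The solution \<open>y\<close> of the second problem is feasible for the first; comparing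
  both objectives there cancels \<open>f\<close>.\<close>

lemma optimal_value_diff_le:
  assumes "0 \<le> \<gamma>" "dual_set \<phi> W" "dual_set \<psi> V"
    and "optimal_solution f \<gamma> \<phi> U X x" "optimal_solution f \<gamma> \<psi> U X y"
    and "norm (U y) \<le> m"
  shows "optimal_value f \<gamma> \<phi> U X - optimal_value f \<gamma> \<psi> U X \<le> \<gamma> * m * hausdorff_dist W V"
proof -
  have "optimal_value f \<gamma> \<phi> U X - optimal_value f \<gamma> \<psi> U X \<le> \<gamma> * (\<phi> (U y) - \<psi> (U y))"
    using optimal_solutionD(2)[OF assms(4) optimal_solutionD(1)[OF assms(5)]]
    by (simp add: optimal_solutionD(3)[OF assms(4)] optimal_solutionD(3)[OF assms(5)]
        right_diff_distrib)
  also have "\<dots> \<le> \<gamma> * (norm (U y) * hausdorff_dist W V)"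
    using dual_set_diff_le[OF assms(2,3)] assms(1) by (rule mult_left_mono)
  \<comment> \<open>Enlarging \<open>norm (U y)\<close> to \<open>m\<close> requires the Hausdorff
    distance to be nonnegative.\<close>
  also have "\<dots> \<le> \<gamma> * (m * hausdorff_dist W V)"
    using assms by (intro mult_left_mono mult_right_mono hausdorff_dist_nonneg)
      (auto simp: dual_set_def)
  finally show ?thesis by (simp add: mult.assoc)
qed

lemma dual_set_arg_max:
  assumes "dual_set \<phi> W" "is_arg_max (\<lambda>w. nu w u) (\<lambda>w. w \<in> W) w"
  shows "w \<in> W" "\<phi> u = nu w u"
proof -
  show "w \<in> W"
    using assms(2) by (simp add: is_arg_max_def)
  have "\<phi> u = (SUP w\<in>W. nu w u)"
    using assms(1) by (simp add: dual_set_def)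
  also have "\<dots> = nu w u"
    by (rule cSup_eq_maximum) (use assms(2) in \<open>auto simp: is_arg_max_linorder\<close>)
  finally show "\<phi> u = nu w u" .
qed

text \<open>\<open>nu w\<close> lies below \<open>\<phi>\<close> everywhere and agrees with it at
  \<open>U x\<close>, so growth for the fixed weight \<open>w\<close> carries over to the objective
  with \<open>\<phi>\<close>.\<close>

lemma growth_le_objective_diff:
  assumes "0 \<le> \<gamma>" "dual_set \<phi> W"
    and "is_arg_max (\<lambda>w. nu w (U x)) (\<lambda>w. w \<in> W) w"
    and "quadratic_growth f \<gamma> U X w x \<tau>" "y \<in> X"
  shows "\<tau> * (norm (y - x))\<^sup>2 \<le> f (U y) + \<gamma> * \<phi> (U y) - (f (U x) + \<gamma> * \<phi> (U x))"
proof -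
  note w = dual_set_arg_max[OF assms(2,3)]
  have "\<tau> * (norm (y - x))\<^sup>2 \<le> f (U y) + \<gamma> * nu w (U y) - f (U x) - \<gamma> * nu w (U x)"
    using assms(4,5) by (simp add: quadratic_growth_def)
  moreover have "\<gamma> * nu w (U y) \<le> \<gamma> * \<phi> (U y)"
    using nu_le_dual_set[OF assms(2) w(1)] assms(1) by (rule mult_left_mono)
  ultimately show ?thesis
    by (simp add: w(2))
qed

text \<open>A maximum is unique when it exists, so quantifying over every \<open>Umax\<close> with
  \<open>is_maximum\<close> speaks of the maximum itself; its existence, which expresses finiteness,
  is the first conjunct.\<close>

theorem theorem6:
  fixes X :: "(real ^ 'n) set"
    and U :: "real ^ 'n \<Rightarrow> real ^ 'N::{finite,linorder}"
    and f :: "real ^ 'N::{finite,linorder} \<Rightarrow> real"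
    and \<gamma> :: real
    and \<nu>1 \<nu>2 :: "real ^ 'N::{finite,linorder} \<Rightarrow> real"
    and W1 W2 :: "(real ^ 'N::{finite,linorder}) set"
    and v1 v2 :: real
    and x1 x2 :: "real ^ 'n"
  assumes "\<gamma> > 0"
    and "convex_fairness_measure \<nu>1" and "convex_fairness_measure \<nu>2"
    and "dual_set \<nu>1 W1" and "dual_set \<nu>2 W2"
    and "v1 = optimal_value f \<gamma> \<nu>1 U X" and "v2 = optimal_value f \<gamma> \<nu>2 U X"
    and "optimal_solution f \<gamma> \<nu>1 U X x1" and "optimal_solution f \<gamma> \<nu>2 U X x2"
    and "compact X"
  shows
    "(continuous_on X U \<longrightarrow> (\<exists>Umax. is_maximum (\<lambda>x. norm (U x)) X Umax)) \<and>
     (\<forall>Umax. is_maximum (\<lambda>x. norm (U x)) X Umax \<longrightarrow>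
        \<bar>v1 - v2\<bar> \<le> \<gamma> * Umax * hausdorff_dist W1 W2 \<and>
        (\<forall>w1 w2 \<tau>1 \<tau>2.
           is_arg_max (\<lambda>w. nu w (U x1)) (\<lambda>w. w \<in> W1) w1 \<and>
           is_arg_max (\<lambda>w. nu w (U x2)) (\<lambda>w. w \<in> W2) w2 \<and>
           \<tau>1 > 0 \<and> quadratic_growth f \<gamma> U X w1 x1 \<tau>1 \<and>
           \<tau>2 > 0 \<and> quadratic_growth f \<gamma> U X w2 x2 \<tau>2 \<longrightarrow>
           norm (x1 - x2) \<le> sqrt (\<gamma> * Umax / min \<tau>1 \<tau>2) * sqrt (hausdorff_dist W1 W2)))"
proof (intro conjI impI allI)
  have x: "x1 \<in> X" "x2 \<in> X"
    using assms(8,9) by (auto dest: optimal_solutionD(1))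
  assume "continuous_on X U"
  then have "continuous_on X (\<lambda>x. norm (U x))"
    by (intro continuous_intros)
  \<comment> \<open>The optimal solutions witness that \<open>X\<close> is nonempty, as the extreme
    value theorem requires.\<close>
  with assms(10) x show "\<exists>Umax. is_maximum (\<lambda>x. norm (U x)) X Umax"
    unfolding is_maximum_def using continuous_attains_sup[of X "\<lambda>x. norm (U x)"] by blast
next
  fix m assume "is_maximum (\<lambda>x. norm (U x)) X m"
  then have m: "norm (U x) \<le> m" if "x \<in> X" for x
    using that by (simp add: is_maximum_def)
  have x: "x1 \<in> X" "x2 \<in> X"
    using assms(8,9) by (auto dest: optimal_solutionD(1))
  let ?d = "hausdorff_dist W1 W2"
  show "\<bar>v1 - v2\<bar> \<le> \<gamma> * m * ?d"
    using optimal_value_diff_le[OF _ assms(4,5,8,9) m[OF x(2)]]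
      optimal_value_diff_le[OF _ assms(5,4,9,8) m[OF x(1)]] assms(1)
    by (simp add: assms(6,7) hausdorff_dist_commute[of W2 W1])
  fix w1 w2 \<tau>1 \<tau>2
  assume "is_arg_max (\<lambda>w. nu w (U x1)) (\<lambda>w. w \<in> W1) w1 \<and>
    is_arg_max (\<lambda>w. nu w (U x2)) (\<lambda>w. w \<in> W2) w2 \<and>
    \<tau>1 > 0 \<and> quadratic_growth f \<gamma> U X w1 x1 \<tau>1 \<and>
    \<tau>2 > 0 \<and> quadratic_growth f \<gamma> U X w2 x2 \<tau>2"
  then have max: "is_arg_max (\<lambda>w. nu w (U x1)) (\<lambda>w. w \<in> W1) w1"
      "is_arg_max (\<lambda>w. nu w (U x2)) (\<lambda>w. w \<in> W2) w2"
    and growth: "quadratic_growth f \<gamma> U X w1 x1 \<tau>1" "quadratic_growth f \<gamma> U X w2 x2 \<tau>2"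
    and pos: "\<tau>1 > 0" "\<tau>2 > 0"
    by auto
  let ?r = "(norm (x1 - x2))\<^sup>2"
  have d: "0 \<le> ?d"
    using assms(4) by (intro hausdorff_dist_nonneg) (auto simp: dual_set_def)
  have diff2: "\<nu>1 (U x2) - \<nu>2 (U x2) \<le> m * ?d"
    using dual_set_diff_le[OF assms(4,5)] mult_right_mono[OF m[OF x(2)] d] by (rule order_trans)
  have "\<nu>2 (U x1) - \<nu>1 (U x1) \<le> norm (U x1) * ?d"
    using dual_set_diff_le[OF assms(5,4)] by (simp add: hausdorff_dist_commute)
  then have diff1: "\<nu>2 (U x1) - \<nu>1 (U x1) \<le> m * ?d"
    using mult_right_mono[OF m[OF x(1)] d] by (rule order_trans)
  have "2 * (min \<tau>1 \<tau>2 * ?r) \<le> \<tau>1 * ?r + \<tau>2 * ?r"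
    using mult_right_mono[of "min \<tau>1 \<tau>2" \<tau>1 ?r] mult_right_mono[of "min \<tau>1 \<tau>2" \<tau>2 ?r] by simp
  \<comment> \<open>In the sum of the two growth bounds the values of \<open>f\<close> cancel,
    leaving differences of the measures at common points.\<close>
  also have "\<dots> \<le> \<gamma> * (\<nu>1 (U x2) - \<nu>2 (U x2)) + \<gamma> * (\<nu>2 (U x1) - \<nu>1 (U x1))"
    using growth_le_objective_diff[OF _ assms(4) max(1) growth(1) x(2)]
      growth_le_objective_diff[OF _ assms(5) max(2) growth(2) x(1)] assms(1)
    by (simp add: norm_minus_commute[of x2 x1] right_diff_distrib)
  also have "\<dots> \<le> \<gamma> * (m * ?d) + \<gamma> * (m * ?d)"
    using diff1 diff2 assms(1) by (intro add_mono mult_left_mono) auto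
  \<comment> \<open>The two equal terms on the right absorb the factor 2 on the left, so the bound
    carries no extra constant.\<close>
  finally have "?r \<le> \<gamma> * m / min \<tau>1 \<tau>2 * ?d"
    using pos by (simp add: field_simps)
  then show "norm (x1 - x2) \<le> sqrt (\<gamma> * m / min \<tau>1 \<tau>2) * sqrt ?d"
    unfolding real_sqrt_mult[symmetric] by (rule real_le_rsqrt)
qed

end
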